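(* Let $\mathcal{D}=(\mathcal{N},\mathcal{A},\nu,l)$ be a decision diagram encoding a discrete optimization problem, and consider the binary program (MILP-$\mathcal{D}$): $$\min_{y\in\{0,1\}^{|\mathcal{A}|}}\ \sum_{a\in\mathcal{A}} l_a y_a$$ subject to $$(1)\ \sum_{a\in\Gamma^+(\mathbf{r})}y_a=1,\qquad (2)\ \sum_{a\in\Gamma^+(u)}y_a-\sum_{a\in\Gamma^-(u)}y_a=0\ \ \forall u\in\mathcal{N}\setminus\{\mathbf{r},\mathbf{t}\},\qquad (3)\ Gy\le d.$$ Let $N$ be the coefficient matrix of $y$ associated with the linear system (1)-(2). If the matrix $\begin{bmatrix}N\\ G\end{bmatrix}$ is totally unimodular and $d$ is integral, then the set of optimal solutions to (MILP-$\mathcal{D}$) is $\mathrm{Proj}_y\,\mathcal{Y}$, where $\mathcal{Y}$ is the set of $(y,\pi,\gamma)\in\mathbb{R}^{|\mathcal{A}|}\times\mathbb{R}^{|\mathcal{N}|}\times\mathbb{R}^{m}$ satisfying $$\gamma\ge 0,\quad y\text{ satisfies }(1)\text{-}(3),\quad \pi_{t_a}-\pi_{h_a}+\gamma^\top G_a\ge l_a\ \ \forall a\in\mathcal{A},\quad l^\top y-\pi_{\mathbf{r}}-\gamma^\top d=0,\quad y\in\{0,1\}^{|\mathcal{A}|}.$$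
   Context: A decision diagram $\mathcal{D}=(\mathcal{N},\mathcal{A},\nu,l)$ with $n\ge 1$ variables is a finite acyclic directed graph (parallel arcs allowed) with node set partitioned into layers $\mathcal{N}_1,\dots,\mathcal{N}_{n+1}$, $\mathcal{N}_1=\{\mathbf{r}\}$, $\mathcal{N}_{n+1}=\{\mathbf{t}\}$. Each arc $a$ goes from a tail node $t_a$ in some layer $\mathcal{N}_j$ to a head node $h_a\in\mathcal{N}_{j+1}$ and carries a value $\nu_a\in\mathbb{Z}$ and a length $l_a\in\mathbb{R}$; $l$ is the vector of arc lengths. For a node $u$, $\Gamma^+(u)$ and $\Gamma^-(u)$ are the sets of arcs leaving and entering $u$. The diagram encodes the discrete problem $\min\{f(x):x\in\mathcal{X}\}$, with $\mathcal{X}\subseteq\mathbb{Z}^n$ finite, if $(a_1,\dots,a_n)\mapsto(\nu_{a_1},\dots,\nu_{a_n})$ is a one-to-one correspondence between $\mathbf{r}$-$\mathbf{t}$ paths and $\mathcal{X}$ and path lengths equal $f$ of the corresponding solutions. $G\in\mathbb{R}^{m\times|\mathcal{A}|}$ and $d\in\mathbb{R}^m$ ($m\ge 1$) are the entrywise non-negative data of the side constraints, and $G_a\in\mathbb{R}^m$ denotes the column of $G$ indexed by arc $a$. It is assumed that at least one $\mathbf{r}$-$\mathbf{t}$ path satisfies $Gy\le d$.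
   Formalization: The printed system fits maximization and is false for min; the formal one uses π_{t_a} − π_{h_a} − γᵀG_a ≤ l_a and lᵀy − π_r + γᵀd = 0 (γ ≥ 0), and adds π_t = 0, without which translating π makes the last equation vacuous. *)

theory Defs
  imports "HOL-Analysis.Analysis" "Jordan_Normal_Form.Determinant"
begin

no_notation Matrix.vec_index (infixl "$" 100)
no_notation Matrix.scalar_prod (infix "\<bullet>" 70)

text \<open>
  The finite types \<open>'v\<close> and \<open>'a\<close> are the node set and the arc set, so that
  vectors indexed by nodes or arcs live in \<open>real ^ 'v\<close> and \<open>real ^ 'a\<close>; distinct
  arcs may share tail and head.  The layer \<open>N\<^sub>j\<close> is the set of nodes \<open>u\<close> with
  \<open>level D u = j\<close>.
\<close>

record ('v, 'a::finite) diagram =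
  nvars :: nat
  level :: "'v \<Rightarrow> nat"
  root_node :: 'v
  terminal_node :: 'v
  tail :: "'a \<Rightarrow> 'v"
  head :: "'a \<Rightarrow> 'v"
  arc_value :: "'a \<Rightarrow> int"
  arc_length :: "real ^ 'a"

definition decision_diagram :: "('v::finite, 'a::finite) diagram \<Rightarrow> bool" where
  "decision_diagram D \<longleftrightarrow>
     nvars D \<ge> 1 \<and>
     (\<forall>u. level D u \<in> {1..nvars D + 1}) \<and>
     {u. level D u = 1} = {root_node D} \<and>
     {u. level D u = nvars D + 1} = {terminal_node D} \<and>
     (\<forall>a. level D (head D a) = level D (tail D a) + 1)"

definition out_arcs :: "('v, 'a::finite) diagram \<Rightarrow> 'v \<Rightarrow> 'a set" where
  "out_arcs D u = {a. tail D a = u}"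

definition in_arcs :: "('v, 'a::finite) diagram \<Rightarrow> 'v \<Rightarrow> 'a set" where
  "in_arcs D u = {a. head D a = u}"

text \<open>In a decision diagram every member of \<open>rt_paths D\<close> has length \<open>nvars D\<close>.\<close>

definition rt_paths :: "('v, 'a::finite) diagram \<Rightarrow> 'a list set" where
  "rt_paths D =
     {p. p \<noteq> [] \<and> tail D (hd p) = root_node D \<and> head D (last p) = terminal_node D \<and>
         successively (\<lambda>a b. head D a = tail D b) p}"

text \<open>\<open>D\<close> encodes the problem of minimizing \<open>f\<close> over the set \<open>X\<close> of integer points;
  points are lists of length \<open>nvars D\<close>.\<close>

definition encodes ::
    "('v::finite, 'a::finite) diagram \<Rightarrow> int list set \<Rightarrow> (int list \<Rightarrow> real) \<Rightarrow> bool" where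
  "encodes D X f \<longleftrightarrow>
     finite X \<and> (\<forall>x\<in>X. length x = nvars D) \<and>
     bij_betw (map (arc_value D)) (rt_paths D) X \<and>
     (\<forall>p\<in>rt_paths D. (\<Sum>a\<leftarrow>p. arc_length D $ a) = f (map (arc_value D) p))"

definition path_vector :: "'a list \<Rightarrow> real ^ 'a::finite" where
  "path_vector p = (\<chi> a. if a \<in> set p then 1 else 0)"

definition binary_vector :: "real ^ 'a::finite \<Rightarrow> bool" where
  "binary_vector y \<longleftrightarrow> (\<forall>a. y $ a \<in> {0, 1})"

definition flow_constraints :: "('v::finite, 'a::finite) diagram \<Rightarrow> real ^ 'a \<Rightarrow> bool" where
  "flow_constraints D y \<longleftrightarrow>
     (\<Sum>a\<in>out_arcs D (root_node D). y $ a) = 1 \<and>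
     (\<forall>u\<in>UNIV - {root_node D, terminal_node D}.
        (\<Sum>a\<in>out_arcs D u. y $ a) - (\<Sum>a\<in>in_arcs D u. y $ a) = 0)"

definition milp_feasible ::
    "('v::finite, 'a::finite) diagram \<Rightarrow> real ^ 'a ^ 'm::finite \<Rightarrow> real ^ 'm \<Rightarrow> real ^ 'a \<Rightarrow> bool"
    where
  "milp_feasible D G d y \<longleftrightarrow> binary_vector y \<and> flow_constraints D y \<and> G *v y \<le> d"

definition milp_optimal_solutions ::
    "('v::finite, 'a::finite) diagram \<Rightarrow> real ^ 'a ^ 'm::finite \<Rightarrow> real ^ 'm \<Rightarrow> (real ^ 'a) set"
    where
  "milp_optimal_solutions D G d =
     {y. is_arg_min (\<lambda>z. arc_length D \<bullet> z) (milp_feasible D G d) y}"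

text \<open>Matrices are given as functions together with finite sets of row and column indices.
  Square submatrices are selected by arbitrary injective enumerations of rows and columns;
  reordering changes the determinant only by a sign.\<close>

definition totally_unimodular :: "'r set \<Rightarrow> 'c set \<Rightarrow> ('r \<Rightarrow> 'c \<Rightarrow> real) \<Rightarrow> bool" where
  "totally_unimodular R C M \<longleftrightarrow>
     (\<forall>k r c. inj_on r {..<k} \<longrightarrow> r ` {..<k} \<subseteq> R \<longrightarrow>
              inj_on c {..<k} \<longrightarrow> c ` {..<k} \<subseteq> C \<longrightarrow>
        Determinant.det (Matrix.mat k k (\<lambda>(i, j). M (r i) (c j))) \<in> {- 1, 0, 1})"

text \<open>The coefficient matrix of \<open>flow_constraints D\<close>; it has one row for each node other than
  the terminal.\<close>

definition flow_matrix :: "('v, 'a::finite) diagram \<Rightarrow> 'v \<Rightarrow> 'a \<Rightarrow> real" where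
  "flow_matrix D u a =
     (if u = root_node D then of_bool (a \<in> out_arcs D u)
      else of_bool (a \<in> out_arcs D u) - of_bool (a \<in> in_arcs D u))"

definition stacked_matrix ::
    "('v, 'a::finite) diagram \<Rightarrow> real ^ 'a ^ 'm::finite \<Rightarrow> 'v + 'm \<Rightarrow> 'a \<Rightarrow> real" where
  "stacked_matrix D G = case_sum (flow_matrix D) (\<lambda>i a. G $ i $ a)"

definition stacked_rows :: "('v, 'a::finite) diagram \<Rightarrow> ('v + 'm) set" where
  "stacked_rows D = (UNIV - {terminal_node D}) <+> UNIV"

text \<open>
  Primal feasibility, dual feasibility and equality of the objectives for the linear
  relaxation \<open>min {l\<^sup>T y | N y = e\<^sub>r, G y \<le> d, y \<ge> 0}\<close>.  As the primal is a minimization with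
  \<open>\<le>\<close> side constraints, the multipliers \<open>\<gamma> \<ge> 0\<close> enter with a negative sign and the reduced
  costs are bounded above by \<open>l\<close>: the dual is
  \<open>max {\<pi>(r) - \<gamma>\<^sup>T d | \<pi>(tail a) - \<pi>(head a) - \<gamma>\<^sup>T G\<^sub>a \<le> l\<^sub>a for all a, \<gamma> \<ge> 0}\<close>.
  The terminal has no flow constraint, hence no dual variable, and its component of \<open>\<pi>\<close> is
  fixed to \<open>0\<close>; if it were free, translating \<open>\<pi>\<close> would make the last equation vacuous.
\<close>

definition opt_system ::
    "('v::finite, 'a::finite) diagram \<Rightarrow> real ^ 'a ^ 'm::finite \<Rightarrow> real ^ 'm
      \<Rightarrow> ((real ^ 'a) \<times> (real ^ 'v) \<times> (real ^ 'm)) set" where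
  "opt_system D G d =
     {(y, \<pi>, \<gamma>).
        0 \<le> \<gamma> \<and>
        flow_constraints D y \<and> G *v y \<le> d \<and>
        (\<forall>a. \<pi> $ tail D a - \<pi> $ head D a - \<gamma> \<bullet> column a G \<le> arc_length D $ a) \<and>
        \<pi> $ terminal_node D = 0 \<and>
        arc_length D \<bullet> y - \<pi> $ root_node D + \<gamma> \<bullet> d = 0 \<and>
        binary_vector y}"

end

theory Submission
  imports Defs
begin

text \<open>
  The binary program and its linear relaxation have the same optimal value, so a binary
  feasible point is optimal exactly when linear programming duality certifies it; the
  system \<open>opt_system\<close> collects precisely such certificates (primal feasibility, dual
  feasibility, equal objectives).

  One inclusion is weak duality (\<open>weak_duality\<close>): a certificate bounds the length of every
  feasible point from below by the length of \<open>y\<close>.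

  For the other inclusion, an optimal \<open>y\<close> must be given multipliers.  The optimal value \<open>v\<close>
  of the binary program bounds the objective at all binary feasible points, and the point is to
  extend this bound to the whole polytope of the relaxation.  By the theorem of Krein and Milman
  it is enough to look at extreme points.  Total unimodularity and an integral right-hand
  side make them integral (\<open>totally_unimodular_extreme_point_integral\<close>), and the layers of
  the diagram make them binary, because exactly one unit of flow crosses each layer
  (\<open>layer_flow\<close>); hence every extreme point is feasible for the binary program.  An
  affine form of the Farkas lemma (\<open>affine_farkas\<close>) then turns the valid inequality
  \<open>v \<le> l \<bullet> x\<close> into the multipliers \<open>\<pi>\<close> and \<open>\<gamma>\<close>, with dual objective at least \<open>v\<close>; weak
  duality at \<open>y\<close> gives equality.

  Integrality of extreme points is the classical Cramer argument.  The support columns of an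
  extreme point, restricted to the tight rows, admit no kernel vector, since such a vector would
  be a direction of motion inside the polytope.  So they contain a nonsingular square
  submatrix with all support columns (\<open>full_minor_or_kernel\<close>), its determinant is
  \<open>1\<close> or \<open>- 1\<close>, and Cramer's rule expresses the support coordinates as integers.
\<close>

section \<open>Nonsingular minors and kernel vectors\<close>
abbreviation selected_minor ::
    "('r \<Rightarrow> 'c \<Rightarrow> 'k::comm_ring_1) \<Rightarrow> nat \<Rightarrow> (nat \<Rightarrow> 'r) \<Rightarrow> (nat \<Rightarrow> 'c) \<Rightarrow> 'k mat" where
  "selected_minor M k r c \<equiv> Matrix.mat k k (\<lambda>(i, j). M (r i) (c j))"

lemma cofactor_last_row_cong:
  fixes A B :: "'k::comm_ring_1 mat"
  assumes "A \<in> carrier_mat (Suc k) (Suc k)" "B \<in> carrier_mat (Suc k) (Suc k)"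
    and "\<And>i j. i < k \<Longrightarrow> j \<le> k \<Longrightarrow> A $$ (i, j) = B $$ (i, j)"
  shows "cofactor A k j = cofactor B k j"
proof -
  have "mat_delete A k j = mat_delete B k j"
    unfolding mat_delete_def using assms by (intro eq_matI) auto
  then show ?thesis by (simp add: cofactor_def)
qed

text \<open>
  Column independence in the form needed for Cramer's rule, with no notion of rank.
  A nonsingular minor of maximal size either uses all columns or can be bordered by a further
  column.  Border it by an arbitrary row as well: the cofactors along the new row do not
  depend on that row, and Laplace expansion of the bordered determinant, which vanishes for
  every row in \<open>R\<close> by maximality or by a repeated row, says that the vector of these cofactors
  is in the kernel.  It is nonzero because the cofactor of the new column is the
  nonsingular minor.
\<close>
lemma full_minor_or_kernel:
  fixes M :: "'r \<Rightarrow> 'c \<Rightarrow> 'k::field"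
  assumes "finite C"
  obtains
    (minor) k r c where "inj_on r {..<k}" "r ` {..<k} \<subseteq> R" "bij_betw c {..<k} C"
      "Determinant.det (selected_minor M k r c) \<noteq> 0"
  | (kernel) v a where "a \<in> C" "v a \<noteq> 0" "\<And>a. a \<notin> C \<Longrightarrow> v a = 0"
      "\<And>i. i \<in> R \<Longrightarrow> (\<Sum>a\<in>C. M i a * v a) = 0"
proof -
  define nonsing where "nonsing k \<longleftrightarrow> (\<exists>r c. inj_on r {..<k} \<and> r ` {..<k} \<subseteq> R \<and>
    inj_on c {..<k} \<and> c ` {..<k} \<subseteq> C \<and> Determinant.det (selected_minor M k r c) \<noteq> 0)" for k
  have bound: "k \<le> card C" if "nonsing k" for k
    using that card_inj_on_le[OF _ _ assms, of _ "{..<k}"] unfolding nonsing_def by auto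
  have "nonsing 0" by (simp add: nonsing_def)
  with bound obtain k where k: "nonsing k" and max: "\<And>k'. nonsing k' \<Longrightarrow> k' \<le> k"
    using Greatest_le_nat[of nonsing _ "card C"] GreatestI_nat[of nonsing 0 "card C"] by blast
  from k obtain r c where rc: "inj_on r {..<k}" "r ` {..<k} \<subseteq> R" "inj_on c {..<k}"
      "c ` {..<k} \<subseteq> C" and nz: "Determinant.det (selected_minor M k r c) \<noteq> 0"
    unfolding nonsing_def by blast
  show thesis
  proof (cases "c ` {..<k} = C")
    case True
    with rc nz show thesis by (intro minor) (auto simp: bij_betw_def)
  next
    case False
    with rc obtain f where f: "f \<in> C" "f \<notin> c ` {..<k}" by blast
    define c' where "c' = c(k := f)"
    have c'_lt: "c' j = c j" if "j < k" for j using that by (simp add: c'_def)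
    have c'_k: "c' k = f" by (simp add: c'_def)
    have inj: "inj_on c' {..<Suc k}"
      using rc f by (auto simp: lessThan_Suc c'_def inj_on_def)
    have sub: "c' ` {..<Suc k} \<subseteq> C"
      using rc f by (auto simp: lessThan_Suc c'_def)
    define B where "B i = selected_minor M (Suc k) (r(k := i)) c'" for i
    have B: "B i \<in> carrier_mat (Suc k) (Suc k)" for i by (simp add: B_def)
    have B_sing: "Determinant.det (B i) = 0" if "i \<in> R" for i
    proof (cases "i \<in> r ` {..<k}")
      case True
      then obtain j where j: "j < k" "i = r j" by auto
      show ?thesis
        by (rule det_identical_rows[OF B, of j k]) (use j in \<open>auto simp: B_def\<close>)
    next
      case False
      have "inj_on (r(k := i)) {..<Suc k}" "(r(k := i)) ` {..<Suc k} \<subseteq> R"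
        using False rc that by (auto simp: lessThan_Suc inj_on_def)
      with inj sub have "nonsing (Suc k)" if "Determinant.det (B i) \<noteq> 0"
        using that unfolding nonsing_def B_def by blast
      with max[of "Suc k"] show ?thesis by auto
    qed
    (* the new row is irrelevant for its own cofactors, so any value serves *)
    define w where "w j = cofactor (B undefined) k j" for j
    have w: "cofactor (B i) k j = w j" for i j
      unfolding w_def by (rule cofactor_last_row_cong[OF B B]) (auto simp: B_def)
    have wk: "w k \<noteq> 0"
    proof -
      have "mat_delete (B undefined) k k = selected_minor M k r c"
        by (intro eq_matI) (auto simp: mat_delete_def B_def c'_def)
      with nz show ?thesis by (simp add: w_def cofactor_def)
    qed
    define v where "v a = (if a \<in> c' ` {..<Suc k} then w (the_inv_into {..<Suc k} c' a) else 0)" for a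
    have v: "v (c' j) = w j" if "j < Suc k" for j
      using that inj by (simp add: v_def the_inv_into_f_f)
    show thesis
    proof (rule kernel[of f v])
      show "f \<in> C" by fact
      show "v f \<noteq> 0" using v[of k] wk by (simp add: c'_k)
      show "v a = 0" if "a \<notin> C" for a using that sub by (auto simp: v_def)
      fix i assume "i \<in> R"
      have "(\<Sum>a\<in>C. M i a * v a) = (\<Sum>a\<in>c' ` {..<Suc k}. M i a * v a)"
        using sub assms by (intro sum.mono_neutral_right) (auto simp: v_def)
      also have "\<dots> = (\<Sum>j<Suc k. M i (c' j) * w j)"
        using inj v by (subst sum.reindex) (auto intro!: sum.cong)
      also have "\<dots> = (\<Sum>j<Suc k. B i $$ (k, j) * cofactor (B i) k j)"
        by (intro sum.cong refl) (simp add: w, simp add: B_def)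
      also have "\<dots> = Determinant.det (B i)"
        by (rule laplace_expansion_row[OF B, symmetric]) simp
      finally show "(\<Sum>a\<in>C. M i a * v a) = 0" using B_sing[OF \<open>i \<in> R\<close>] by simp
    qed
  qed
qed

section \<open>Integrality of extreme points under total unimodularity\<close>
lemma det_in_Ints:
  fixes A :: "'k::comm_ring_1 mat"
  assumes "A \<in> carrier_mat n n" "\<And>i j. i < n \<Longrightarrow> j < n \<Longrightarrow> A $$ (i, j) \<in> \<int>"
  shows "Determinant.det A \<in> \<int>"
  unfolding det_def'[OF assms(1)]
  by (intro Ints_sum Ints_mult Ints_prod assms(2)) (auto dest: permutes_in_image)

lemma totally_unimodular_entry:
  assumes "totally_unimodular R C M" "i \<in> R" "a \<in> C"
  shows "M i a \<in> {-1, 0, 1}"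
proof -
  have "Determinant.det (selected_minor M 1 (\<lambda>_. i) (\<lambda>_. a)) \<in> {-1, 0, 1}"
    using assms(2,3)
    by (intro assms(1)[unfolded totally_unimodular_def, rule_format]) (auto simp: inj_on_def)
  then show ?thesis by (simp add: det_single)
qed

text \<open>
  Cramer's rule: the determinant of the system is \<open>1\<close> or \<open>- 1\<close>, and the
  determinants in the numerators have integer entries.
\<close>
lemma totally_unimodular_solution_integral:
  fixes x :: "'c \<Rightarrow> real"
  assumes tu: "totally_unimodular R C' M"
    and minor: "inj_on r {..<k}" "r ` {..<k} \<subseteq> R" "bij_betw c {..<k} C" "C \<subseteq> C'"
      "Determinant.det (selected_minor M k r c) \<noteq> 0"
    and sol: "\<And>i. i \<in> r ` {..<k} \<Longrightarrow> (\<Sum>a\<in>C. M i a * x a) \<in> \<int>"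
    and "a \<in> C"
  shows "x a \<in> \<int>"
proof -
  let ?A = "selected_minor M k r c"
  define X where "X = Matrix.vec k (\<lambda>j. x (c j))"
  from minor(3) \<open>a \<in> C\<close> obtain j where j: "j < k" "a = c j"
    by (auto simp: bij_betw_def)
  have c: "inj_on c {..<k}" "c ` {..<k} = C" using minor(3) by (auto simp: bij_betw_def)
  have A: "?A \<in> carrier_mat k k" by simp
  have AX: "vec_index (?A *\<^sub>v X) i = (\<Sum>a\<in>C. M (r i) a * x a)" if "i < k" for i
  proof -
    have "vec_index (?A *\<^sub>v X) i = (\<Sum>j<k. M (r i) (c j) * x (c j))"
      using that by (simp add: X_def Matrix.scalar_prod_def lessThan_atLeast0)
    also have "\<dots> = (\<Sum>a\<in>c ` {..<k}. M (r i) a * x a)"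
      using c(1) by (simp add: sum.reindex)
    finally show ?thesis using c(2) by simp
  qed
  have entries: "M (r i) (c l) \<in> \<int>" if "i < k" "l < k" for i l
    using totally_unimodular_entry[OF tu, of "r i" "c l"] that minor c by fastforce
  have "Determinant.det (replace_col ?A (?A *\<^sub>v X) j) = vec_index X j * Determinant.det ?A"
    by (rule cramer_lemma_mat[OF A _ j(1)]) (simp add: X_def)
  moreover have "Determinant.det (replace_col ?A (?A *\<^sub>v X) j) \<in> \<int>"
    by (rule det_in_Ints[of _ k])
      (use entries AX sol in \<open>auto simp: replace_col_def simp del: index_mult_mat_vec\<close>)
  moreover have "Determinant.det ?A \<in> {-1, 1}"
    using tu[unfolded totally_unimodular_def, rule_format, of r k c] minor c by auto
  ultimately show ?thesis using j by (auto simp: X_def minus_in_Ints_iff)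
qed

text \<open>
  Below, the equation rows \<open>E\<close> form a subset of \<open>R\<close>, so that total unimodularity and
  integrality of the right-hand side are conditions on the single row set \<open>R\<close>.
\<close>
definition std_polyhedron ::
    "'r set \<Rightarrow> 'r set \<Rightarrow> ('r \<Rightarrow> 'a::finite \<Rightarrow> real) \<Rightarrow> ('r \<Rightarrow> real) \<Rightarrow> (real ^ 'a) set" where
  "std_polyhedron E R M b = {x. 0 \<le> x \<and> (\<forall>i\<in>R. (\<Sum>a\<in>UNIV. M i a * x $ a) \<le> b i) \<and>
     (\<forall>i\<in>E. (\<Sum>a\<in>UNIV. M i a * x $ a) = b i)}"

text \<open>
  A vector that respects the zero coordinates and is annihilated by the tight rows keeps
  every constraint that holds with equality, and small steps keep the strict ones.  So
  both \<open>x + t v\<close> and \<open>x - t v\<close> stay in the polyhedron for a small \<open>t > 0\<close>, with midpoint \<open>x\<close>.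
\<close>
lemma extreme_point_no_feasible_direction:
  fixes x :: "real ^ 'a::finite"
  assumes "finite R" "E \<subseteq> R"
    and ext: "x extreme_point_of (std_polyhedron E R M b)"
    and supp: "\<And>a. x $ a = 0 \<Longrightarrow> v $ a = 0"
    and tight: "\<And>i. i \<in> R \<Longrightarrow> (\<Sum>a\<in>UNIV. M i a * x $ a) = b i \<Longrightarrow> (\<Sum>a\<in>UNIV. M i a * v $ a) = 0"
  shows "v = 0"
proof (rule ccontr)
  assume "v \<noteq> 0"
  let ?P = "std_polyhedron E R M b"
  let ?row = "\<lambda>i z. \<Sum>a\<in>UNIV. M i a * z $ a"
  have x: "x \<in> ?P" using ext by (simp add: extreme_point_of_def)
  (* p is the change of a constraint per unit step, q its slack at x *)
  have small: "\<forall>\<^sub>F t in at_right (0::real). \<bar>t * p\<bar> \<le> q" if "0 \<le> q" "q = 0 \<Longrightarrow> p = 0" for p q :: real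
  proof (cases "q = 0")
    case True
    with that show ?thesis by simp
  next
    case False
    have "((\<lambda>t. \<bar>t * p\<bar>) \<longlongrightarrow> \<bar>0 * p\<bar>) (at_right 0)" by (intro tendsto_intros)
    with False that have "\<forall>\<^sub>F t in at_right (0::real). \<bar>t * p\<bar> < q"
      by (intro order_tendstoD(2)) auto
    then show ?thesis by (rule eventually_mono) simp
  qed
  have "\<forall>\<^sub>F t in at_right (0::real). \<forall>a\<in>UNIV. \<bar>t * v $ a\<bar> \<le> x $ a"
    using x supp by (intro eventually_ball_finite ballI small)
      (auto simp: std_polyhedron_def Finite_Cartesian_Product.less_eq_vec_def)
  moreover have "\<forall>\<^sub>F t in at_right (0::real). \<forall>i\<in>R. \<bar>t * ?row i v\<bar> \<le> b i - ?row i x"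
    using x tight \<open>finite R\<close> by (intro eventually_ball_finite ballI small)
      (auto simp: std_polyhedron_def)
  ultimately have "\<forall>\<^sub>F t in at_right (0::real). 0 < t \<and> (\<forall>a. \<bar>t * v $ a\<bar> \<le> x $ a) \<and>
      (\<forall>i\<in>R. \<bar>t * ?row i v\<bar> \<le> b i - ?row i x)"
    using eventually_at_right_less[of 0] by eventually_elim auto
  then obtain t where t: "0 < t" "\<And>a. \<bar>t * v $ a\<bar> \<le> x $ a"
      "\<And>i. i \<in> R \<Longrightarrow> \<bar>t * ?row i v\<bar> \<le> b i - ?row i x"
    by (auto dest!: eventually_happens)
  have row_add: "?row i (x + s *\<^sub>R v) = ?row i x + s * ?row i v" for i s
    by (simp add: algebra_simps sum.distrib sum_distrib_left)
  have mem: "x + s *\<^sub>R v \<in> ?P" if s: "\<bar>s\<bar> = t" for s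
  proof -
    have "\<bar>s * z\<bar> = \<bar>t * z\<bar>" for z using s by (auto simp: abs_mult)
    then have coord: "0 \<le> x $ a + s * v $ a"
      and row: "i \<in> R \<Longrightarrow> ?row i x + s * ?row i v \<le> b i" for a i
      using t(2)[of a] t(3)[of i] by (smt (verit))+
    have "?row i x + s * ?row i v = b i" if "i \<in> E" for i
      using x tight[of i] that \<open>E \<subseteq> R\<close> by (auto simp: std_polyhedron_def)
    then show ?thesis
      unfolding std_polyhedron_def mem_Collect_eq row_add
      using coord row by (simp add: Finite_Cartesian_Product.less_eq_vec_def)
  qed
  have "x \<in> open_segment (x + t *\<^sub>R v) (x + (- t) *\<^sub>R v)"
  proof -
    have "x = (1 - 1 / 2) *\<^sub>R (x + t *\<^sub>R v) + (1 / 2) *\<^sub>R (x + (- t) *\<^sub>R v)"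
      by (simp add: algebra_simps flip: scaleR_add_left)
    moreover have "x + t *\<^sub>R v \<noteq> x + (- t) *\<^sub>R v"
      using t(1) \<open>v \<noteq> 0\<close> by (auto simp: eq_neg_iff_add_eq_0 simp flip: scaleR_add_left)
    ultimately show ?thesis unfolding in_segment
      by (intro conjI exI[of _ "1/2"]) auto
  qed
  with mem[of t] mem[of "- t"] t(1) ext show False
    by (auto simp: extreme_point_of_def)
qed

text \<open>
  The dichotomy of minor and kernel vector is applied to the support columns and the tight rows:
  a kernel vector contradicts extremality, and a minor makes Cramer's rule applicable.
\<close>
theorem totally_unimodular_extreme_point_integral:
  fixes x :: "real ^ 'a::finite"
  assumes "finite R" "E \<subseteq> R" "totally_unimodular R UNIV M" "\<And>i. i \<in> R \<Longrightarrow> b i \<in> \<int>"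
    and ext: "x extreme_point_of (std_polyhedron E R M b)"
  shows "x $ a \<in> \<int>"
proof (cases "x $ a = 0")
  case False
  let ?C = "{a. x $ a \<noteq> 0}" and ?T = "{i \<in> R. (\<Sum>a\<in>UNIV. M i a * x $ a) = b i}"
  have restrict: "(\<Sum>a\<in>?C. M i a * z a) = (\<Sum>a\<in>UNIV. M i a * z a)"
    if "\<And>a. x $ a = 0 \<Longrightarrow> z a = 0" for i z
    using that by (intro sum.mono_neutral_left) auto
  show ?thesis
  proof (rule full_minor_or_kernel[of ?C ?T M])
    show "finite ?C" by simp
    fix k r c
    assume minor: "inj_on r {..<k}" "r ` {..<k} \<subseteq> ?T" "bij_betw c {..<k} ?C"
      "Determinant.det (selected_minor M k r c) \<noteq> 0"
    show ?thesis
    proof (rule totally_unimodular_solution_integral[OF assms(3) minor(1) _ minor(3) _ minor(4)])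
      show "(\<Sum>a\<in>?C. M i a * x $ a) \<in> \<int>" if "i \<in> r ` {..<k}" for i
        using that minor(2) assms(4) restrict[of "\<lambda>a. x $ a" i] by auto
    qed (use minor(2) False in auto)
  next
    fix v a'
    assume kernel: "a' \<in> ?C" "v a' \<noteq> 0" "\<And>a. a \<notin> ?C \<Longrightarrow> v a = 0"
      "\<And>i. i \<in> ?T \<Longrightarrow> (\<Sum>a\<in>?C. M i a * v a) = 0"
    have "(\<chi> a. v a) = 0"
    proof (rule extreme_point_no_feasible_direction[OF assms(1,2) ext])
      show "(\<chi> a. v a) $ a = 0" if "x $ a = 0" for a using kernel(3) that by simp
      show "(\<Sum>a\<in>UNIV. M i a * (\<chi> a. v a) $ a) = 0"
        if "i \<in> R" "(\<Sum>a\<in>UNIV. M i a * x $ a) = b i" for i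
        using kernel(4)[of i] kernel(3) that restrict[of v i] by simp
    qed
    with kernel(2) show ?thesis by (simp add: Finite_Cartesian_Product.vec_eq_iff)
  qed
qed simp

section \<open>The Farkas lemma and linear programming multipliers\<close>
lemma convex_cone_hull_finite_image:
  fixes g :: "'i \<Rightarrow> 'e::real_vector"
  assumes "finite I" "x \<in> convex_cone hull (g ` I)"
  obtains s where "\<And>i. i \<in> I \<Longrightarrow> 0 \<le> s i" "x = (\<Sum>i\<in>I. s i *\<^sub>R g i)"
proof -
  let ?K = "{x. \<exists>s. (\<forall>i\<in>I. 0 \<le> s i) \<and> x = (\<Sum>i\<in>I. s i *\<^sub>R g i)}"
  have "convex_cone hull (g ` I) \<subseteq> ?K"
  proof (rule hull_minimal)
    show "g ` I \<subseteq> ?K"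
    proof clarify
      fix i assume "i \<in> I"
      with assms(1) show "\<exists>s. (\<forall>j\<in>I. 0 \<le> s j) \<and> g i = (\<Sum>j\<in>I. s j *\<^sub>R g j)"
        by (intro exI[of _ "\<lambda>j. of_bool (j = i)"]) (simp add: of_bool_def if_distrib[of "\<lambda>c. c *\<^sub>R _"] cong: if_cong)
    qed
    have "0 \<in> ?K" by (auto intro!: exI[of _ "\<lambda>_. 0"])
    then show "convex_cone ?K"
      unfolding convex_cone_iff
    proof (intro conjI ballI impI allI)
      show "x + y \<in> ?K" if "x \<in> ?K" "y \<in> ?K" for x y
        using that
      proof clarify
        fix s s' :: "'i \<Rightarrow> real" assume "\<forall>i\<in>I. 0 \<le> s i" "\<forall>i\<in>I. 0 \<le> s' i"
        then show "\<exists>u. (\<forall>i\<in>I. 0 \<le> u i) \<and>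
            (\<Sum>i\<in>I. s i *\<^sub>R g i) + (\<Sum>i\<in>I. s' i *\<^sub>R g i) = (\<Sum>i\<in>I. u i *\<^sub>R g i)"
          by (intro exI[of _ "\<lambda>i. s i + s' i"]) (simp add: scaleR_add_left sum.distrib)
      qed
      show "c *\<^sub>R x \<in> ?K" if "x \<in> ?K" "0 \<le> c" for x c
        using that
      proof clarify
        fix s :: "'i \<Rightarrow> real" assume "\<forall>i\<in>I. 0 \<le> s i"
        with \<open>0 \<le> c\<close> show "\<exists>u. (\<forall>i\<in>I. 0 \<le> u i) \<and>
            c *\<^sub>R (\<Sum>i\<in>I. s i *\<^sub>R g i) = (\<Sum>i\<in>I. u i *\<^sub>R g i)"
          by (intro exI[of _ "\<lambda>i. c * s i"]) (simp add: scaleR_sum_right)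
      qed
    qed
  qed
  with assms(2) that show thesis by blast
qed

text \<open>
  Every inequality valid on a nonempty polyhedron is a nonnegative combination of the
  defining inequalities, weakened in its constant.  The pairs \<open>(c, v)\<close> of such combinations
  form the cone generated by the pairs \<open>(g i, \<beta> i)\<close> and the weakening \<open>(0, - 1)\<close>.  It is
  closed, being finitely generated, so a pair outside it is separated by some \<open>(z, w)\<close>
  with \<open>w \<le> 0\<close>.  If \<open>w < 0\<close>, rescaling \<open>z\<close> yields a point of the polyhedron that
  violates the inequality.  If \<open>w = 0\<close>, then \<open>z\<close> is a recession direction, and on the
  ray from \<open>x0\<close> along \<open>z\<close> the objective decreases without bound.
\<close>
theorem affine_farkas:
  fixes g :: "'i \<Rightarrow> 'e::euclidean_space"
  assumes "finite I" and x0: "\<And>i. i \<in> I \<Longrightarrow> \<beta> i \<le> g i \<bullet> x0"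
    and valid: "\<And>x. (\<And>i. i \<in> I \<Longrightarrow> \<beta> i \<le> g i \<bullet> x) \<Longrightarrow> v \<le> c \<bullet> x"
  obtains s where "\<And>i. i \<in> I \<Longrightarrow> 0 \<le> s i" "c = (\<Sum>i\<in>I. s i *\<^sub>R g i)" "v \<le> (\<Sum>i\<in>I. s i * \<beta> i)"
proof -
  (* None indexes the generator that weakens the constant *)
  define h where "h = case_option (0, -1) (\<lambda>i. (g i, \<beta> i))"
  let ?J = "insert None (Some ` I)"
  let ?K = "convex_cone hull (h ` ?J)"
  have mem: "(c, v) \<in> ?K"
  proof (rule ccontr)
    assume "(c, v) \<notin> ?K"
    then obtain p \<delta> where sep: "p \<bullet> (c, v) < \<delta>" "\<And>k. k \<in> ?K \<Longrightarrow> \<delta> < p \<bullet> k"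
      using separating_hyperplane_closed_point[of ?K "(c, v)"] \<open>finite I\<close>
        convex_convex_cone_hull closed_convex_cone_hull[of "h ` ?J"] by blast
    have "\<delta> < 0" using sep(2)[OF convex_cone_hull_contains_0] by simp
    have nonneg: "0 \<le> p \<bullet> k" if "k \<in> ?K" for k
    proof (rule ccontr)
      assume neg: "\<not> 0 \<le> p \<bullet> k"
      (* this multiple of k lies in the cone and exactly on the separating hyperplane *)
      have "\<delta> < p \<bullet> ((\<delta> / (p \<bullet> k)) *\<^sub>R k)"
        using neg \<open>\<delta> < 0\<close> that
        by (intro sep(2) convex_cone_hull_mul) (auto intro: divide_nonpos_nonpos)
      with neg show False by simp
    qed
    obtain z w where p: "p = (z, w)" by fastforce
    have gen: "0 \<le> p \<bullet> h j" if "j \<in> ?J" for j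
      using that by (intro nonneg hull_inc imageI)
    have w: "w \<le> 0" using gen[of None] by (simp add: p h_def)
    have z: "0 \<le> g i \<bullet> z + w * \<beta> i" if "i \<in> I" for i
      using gen[of "Some i"] that by (simp add: p h_def inner_commute)
    have cv: "c \<bullet> z + w * v < 0" using sep(1) \<open>\<delta> < 0\<close> by (simp add: p inner_commute mult.commute)
    show False
    proof (cases "w = 0")
      case True
      have "v \<le> c \<bullet> (x0 + t *\<^sub>R z)" if "0 \<le> t" for t
      proof (rule valid)
        fix i assume "i \<in> I"
        with x0 z[of i] True that show "\<beta> i \<le> g i \<bullet> (x0 + t *\<^sub>R z)"
          by (simp add: inner_add_right add_increasing2)
      qed
      (* the step length at which the objective has dropped to v - 1 *)
      moreover have "0 \<le> (c \<bullet> x0 - v + 1) / - (c \<bullet> z)"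
        using valid[OF x0] cv True by (intro divide_nonneg_pos) auto
      ultimately have "v \<le> c \<bullet> (x0 + ((c \<bullet> x0 - v + 1) / - (c \<bullet> z)) *\<^sub>R z)" .
      also have "\<dots> = v - 1"
        using cv True unfolding inner_add_right inner_scaleR_right by simp
      finally show False by simp
    next
      case False
      with w have "w < 0" by simp
      have "v \<le> c \<bullet> ((1 / - w) *\<^sub>R z)"
      proof (rule valid)
        fix i assume "i \<in> I"
        with z[of i] \<open>w < 0\<close> show "\<beta> i \<le> g i \<bullet> ((1 / - w) *\<^sub>R z)"
          by (simp add: field_simps)
      qed
      with cv \<open>w < 0\<close> show False by (simp add: field_simps)
    qed
  qed
  obtain s where s: "\<And>j. j \<in> ?J \<Longrightarrow> 0 \<le> s j" "(c, v) = (\<Sum>j\<in>?J. s j *\<^sub>R h j)"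
    by (rule convex_cone_hull_finite_image[OF _ mem]) (use \<open>finite I\<close> in auto)
  have "(\<Sum>j\<in>?J. s j *\<^sub>R h j) = (0, - s None) + (\<Sum>i\<in>I. (s (Some i) *\<^sub>R g i, s (Some i) * \<beta> i))"
    using \<open>finite I\<close> by (simp add: h_def sum.reindex image_iff)
  also have "\<dots> = (\<Sum>i\<in>I. s (Some i) *\<^sub>R g i, (\<Sum>i\<in>I. s (Some i) * \<beta> i) - s None)"
    by (simp add: prod_eq_iff fst_sum snd_sum)
  finally have "c = (\<Sum>i\<in>I. s (Some i) *\<^sub>R g i)" "v = (\<Sum>i\<in>I. s (Some i) * \<beta> i) - s None"
    using s(2) by auto
  with s(1) that[of "\<lambda>i. s (Some i)"] show thesis by auto
qed

text \<open>
  The dual solution for a minimization over a polyhedron in standard form.  Inequality rows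
  \<open>M x \<le> b\<close> are used with reversed sign in \<open>affine_farkas\<close>, which makes their multipliers
  nonpositive; an equation contributes both directions and hence a multiplier of free
  sign; the multipliers of \<open>0 \<le> x\<close> are the slacks of the dual inequalities.
\<close>
theorem std_polyhedron_dual_multipliers:
  fixes c :: "real ^ 'a::finite"
  assumes "finite R" "E \<subseteq> R" and x0: "x0 \<in> std_polyhedron E R M b"
    and valid: "\<And>x. x \<in> std_polyhedron E R M b \<Longrightarrow> v \<le> c \<bullet> x"
  obtains \<mu> where "\<And>i. i \<in> R - E \<Longrightarrow> \<mu> i \<le> 0" "\<And>a. (\<Sum>i\<in>R. \<mu> i * M i a) \<le> c $ a"
    "v \<le> (\<Sum>i\<in>R. \<mu> i * b i)"
proof -
  define row where "row i = (\<chi> a. M i a)" for i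
  define g where "g = case_sum (\<lambda>a. axis a 1) (case_sum (\<lambda>i. - row i) row)"
  define \<beta> where "\<beta> = case_sum (\<lambda>_::'a. 0) (case_sum (\<lambda>i. - b i) b)"
  define I where "I = (UNIV :: 'a set) <+> (R <+> E)"
  have fin: "finite R" "finite E" "finite I"
    using assms(1,2) by (auto simp: I_def intro: finite_subset)
  have row: "row i \<bullet> x = (\<Sum>a\<in>UNIV. M i a * x $ a)" for i x
    by (simp add: row_def inner_vec_def)
  have feas: "x \<in> std_polyhedron E R M b \<longleftrightarrow> (\<forall>i\<in>I. \<beta> i \<le> g i \<bullet> x)" for x
  proof -
    have "(\<forall>i\<in>I. \<beta> i \<le> g i \<bullet> x) \<longleftrightarrow> (\<forall>a. 0 \<le> x $ a) \<and>
        (\<forall>i\<in>R. row i \<bullet> x \<le> b i) \<and> (\<forall>i\<in>E. b i \<le> row i \<bullet> x)"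
      by (simp add: I_def Plus_def ball_Un g_def \<beta>_def inner_axis')
    moreover have "(\<forall>i\<in>R. row i \<bullet> x \<le> b i) \<and> (\<forall>i\<in>E. b i \<le> row i \<bullet> x) \<longleftrightarrow>
        (\<forall>i\<in>R. row i \<bullet> x \<le> b i) \<and> (\<forall>i\<in>E. row i \<bullet> x = b i)"
      unfolding order.eq_iff[where 'a = real] using assms(2) by blast
    ultimately show ?thesis
      by (simp only: std_polyhedron_def mem_Collect_eq row
          Finite_Cartesian_Product.less_eq_vec_def zero_index)
  qed
  obtain s where s: "\<And>i. i \<in> I \<Longrightarrow> 0 \<le> s i" "c = (\<Sum>i\<in>I. s i *\<^sub>R g i)" "v \<le> (\<Sum>i\<in>I. s i * \<beta> i)"
    using affine_farkas[of I \<beta> g x0 v c] fin(3) x0 valid unfolding feas by blast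
  define \<mu> where "\<mu> i = (if i \<in> E then s (Inr (Inr i)) else 0) - s (Inr (Inl i))" for i
  have \<mu>_sum: "(\<Sum>i\<in>R. \<mu> i * q i) =
      (\<Sum>i\<in>E. s (Inr (Inr i)) * q i) - (\<Sum>i\<in>R. s (Inr (Inl i)) * q i)" for q :: "_ \<Rightarrow> real"
  proof -
    have "(\<Sum>i\<in>R. (if i \<in> E then s (Inr (Inr i)) else 0) * q i) = (\<Sum>i\<in>E. s (Inr (Inr i)) * q i)"
      using fin assms(2) by (intro sum.mono_neutral_cong_right) auto
    then show ?thesis by (simp add: \<mu>_def left_diff_distrib sum_subtractf)
  qed
  show thesis
  proof (rule that[of \<mu>])
    show "\<mu> i \<le> 0" if "i \<in> R - E" for i
      using that s(1)[of "Inr (Inl i)"] by (auto simp: \<mu>_def I_def)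
    show "v \<le> (\<Sum>i\<in>R. \<mu> i * b i)"
      using s(3) fin by (simp add: I_def sum.Plus \<beta>_def \<mu>_sum sum_negf)
    fix a
    have "c $ a = (\<Sum>a'\<in>UNIV. s (Inl a') * axis a' 1 $ a) + (\<Sum>i\<in>R. \<mu> i * M i a)"
      using s(2) fin by (simp add: I_def sum.Plus g_def \<mu>_sum sum_negf row_def)
    moreover have "0 \<le> (\<Sum>a'\<in>UNIV. s (Inl a') * axis a' 1 $ a)"
      using s(1) by (intro sum_nonneg mult_nonneg_nonneg) (auto simp: I_def axis_def)
    ultimately show "(\<Sum>i\<in>R. \<mu> i * M i a) \<le> c $ a" by simp
  qed
qed

section \<open>Convexity and closedness\<close>
lemma convex_std_polyhedron:
  fixes M :: "'r \<Rightarrow> 'a::finite \<Rightarrow> real"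
  shows "convex (std_polyhedron E R M b)"
proof (rule convexI)
  fix x y :: "real ^ 'a" and u w :: real
  assume P: "x \<in> std_polyhedron E R M b" "y \<in> std_polyhedron E R M b" and uw: "0 \<le> u" "0 \<le> w" "u + w = 1"
  let ?row = "\<lambda>i z. \<Sum>a\<in>UNIV. M i a * z $ a"
  have row: "?row i (u *\<^sub>R x + w *\<^sub>R y) = u * ?row i x + w * ?row i y" for i
    by (simp add: algebra_simps sum.distrib sum_distrib_left)
  have b: "b i = u * b i + w * b i" for i
    using uw(3) by (metis distrib_right mult_1)
  show "u *\<^sub>R x + w *\<^sub>R y \<in> std_polyhedron E R M b"
    unfolding std_polyhedron_def mem_Collect_eq row
  proof (intro conjI ballI)
    show "0 \<le> u *\<^sub>R x + w *\<^sub>R y"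
      using P uw by (simp add: std_polyhedron_def Finite_Cartesian_Product.less_eq_vec_def)
    show "u * ?row i x + w * ?row i y \<le> b i" if "i \<in> R" for i
      using P uw that by (subst b) (auto simp: std_polyhedron_def intro!: add_mono mult_left_mono)
    show "u * ?row i x + w * ?row i y = b i" if "i \<in> E" for i
      using P that by (subst b) (simp add: std_polyhedron_def)
  qed
qed

lemma closed_std_polyhedron: "closed (std_polyhedron E R M b)"
proof -
  have "std_polyhedron E R M b = (\<Inter>a. {x. 0 \<le> x $ a}) \<inter>
      (\<Inter>i\<in>R. {x. (\<Sum>a\<in>UNIV. M i a * x $ a) \<le> b i}) \<inter>
      (\<Inter>i\<in>E. {x. (\<Sum>a\<in>UNIV. M i a * x $ a) = b i})"
    by (auto simp: std_polyhedron_def Finite_Cartesian_Product.less_eq_vec_def)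
  also have "closed \<dots>"
    by (intro closed_Int closed_INT ballI closed_Collect_le closed_Collect_eq continuous_intros)
  finally show ?thesis .
qed

section \<open>Flows in a decision diagram\<close>

lemma
  assumes "decision_diagram D"
  shows head_not_root: "head D a \<noteq> root_node D"
    and root_not_terminal: "root_node D \<noteq> terminal_node D"
proof -
  have "level D (root_node D) = 1" "level D (terminal_node D) = nvars D + 1" "1 \<le> nvars D"
    "level D (head D a) = level D (tail D a) + 1" "1 \<le> level D (tail D a)"
    using assms unfolding decision_diagram_def by (auto simp: set_eq_iff)
  then show "head D a \<noteq> root_node D" "root_node D \<noteq> terminal_node D" by auto
qed

text \<open>
  The row of the root has the same shape as the others because no arc enters the root, so
  the flow matrix is the node-arc incidence matrix.
\<close>
lemma flow_matrix_eq:
  assumes "decision_diagram D"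
  shows "flow_matrix D u a = of_bool (tail D a = u) - of_bool (head D a = u)"
  using head_not_root[OF assms] by (auto simp: flow_matrix_def out_arcs_def in_arcs_def)

lemma flow_constraints_iff:
  assumes "decision_diagram D"
  shows "flow_constraints D x \<longleftrightarrow>
    (\<forall>u. u \<noteq> terminal_node D \<longrightarrow> (\<Sum>a\<in>UNIV. flow_matrix D u a * x $ a) = of_bool (u = root_node D))"
proof -
  have row: "(\<Sum>a\<in>UNIV. flow_matrix D u a * x $ a) =
      (\<Sum>a\<in>out_arcs D u. x $ a) - (\<Sum>a\<in>in_arcs D u. x $ a)" for u
    by (simp add: flow_matrix_eq[OF assms] left_diff_distrib sum_subtractf sum_of_bool_mult_eq
        out_arcs_def in_arcs_def)
  have "in_arcs D (root_node D) = {}"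
    using head_not_root[OF assms] by (auto simp: in_arcs_def)
  then show ?thesis
    unfolding flow_constraints_def row using root_not_terminal[OF assms] by auto
qed

text \<open>
  All arcs between two consecutive layers carry one unit of flow in total: summing
  conservation over the nodes of a layer equates the flow into and out of it, and the root
  sends out one unit.
\<close>
lemma layer_flow:
  assumes D: "decision_diagram D" and flow: "flow_constraints D x"
    and "1 \<le> j" "j \<le> nvars D"
  shows "(\<Sum>a | level D (tail D a) = j. x $ a) = 1"
  using assms(3,4)
proof (induction j rule: dec_induct)
  case base
  have "{a. level D (tail D a) = 1} = out_arcs D (root_node D)"
    using D by (auto simp: decision_diagram_def out_arcs_def set_eq_iff)
  with flow show ?case by (simp add: flow_constraints_def)
next
  case (step j)
  let ?L = "{u. level D u = Suc j}"
  have inner: "u \<in> UNIV - {root_node D, terminal_node D}" if "u \<in> ?L" for u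
  proof -
    have "level D (root_node D) = 1" "level D (terminal_node D) = nvars D + 1"
      using D unfolding decision_diagram_def by auto
    with that step.hyps step.prems show ?thesis by auto
  qed
  have "(\<Sum>a | level D (tail D a) = Suc j. x $ a) =
      (\<Sum>u\<in>?L. \<Sum>a\<in>{a \<in> {a. level D (tail D a) = Suc j}. tail D a = u}. x $ a)"
    by (subst sum.group) auto
  also have "\<dots> = (\<Sum>u\<in>?L. \<Sum>a\<in>out_arcs D u. x $ a)"
    by (intro sum.cong) (auto simp: out_arcs_def)
  also have "\<dots> = (\<Sum>u\<in>?L. \<Sum>a\<in>in_arcs D u. x $ a)"
  proof (rule sum.cong[OF refl])
    fix u assume "u \<in> ?L"
    with flow inner show "(\<Sum>a\<in>out_arcs D u. x $ a) = (\<Sum>a\<in>in_arcs D u. x $ a)"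
      unfolding flow_constraints_def by fastforce
  qed
  also have "\<dots> = (\<Sum>u\<in>?L. \<Sum>a\<in>{a \<in> {a. level D (head D a) = Suc j}. head D a = u}. x $ a)"
    by (intro sum.cong) (auto simp: in_arcs_def)
  also have "\<dots> = (\<Sum>a | level D (head D a) = Suc j. x $ a)"
    by (subst sum.group) auto
  also have "\<dots> = (\<Sum>a | level D (tail D a) = j. x $ a)"
    using D by (simp add: decision_diagram_def)
  finally show ?case using step by simp
qed

lemma flow_le_1:
  assumes D: "decision_diagram D" and "flow_constraints D x" "0 \<le> x"
  shows "x $ a \<le> 1"
proof -
  let ?j = "level D (tail D a)"
  have "?j + 1 \<le> nvars D + 1" "1 \<le> ?j"
    using D unfolding decision_diagram_def by (metis atLeastAtMost_iff)+
  then have "(\<Sum>a | level D (tail D a) = ?j. x $ a) = 1"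
    by (intro layer_flow assms) auto
  moreover have "x $ a \<le> (\<Sum>a | level D (tail D a) = ?j. x $ a)"
    using assms(3) by (intro member_le_sum) (auto simp: Finite_Cartesian_Product.less_eq_vec_def)
  ultimately show ?thesis by simp
qed

section \<open>The linear relaxation and its vertices\<close>
definition flow_polytope ::
    "('v::finite, 'a::finite) diagram \<Rightarrow> real ^ 'a ^ 'm::finite \<Rightarrow> real ^ 'm \<Rightarrow> (real ^ 'a) set" where
  "flow_polytope D G d = {x. 0 \<le> x \<and> flow_constraints D x \<and> G *v x \<le> d}"

definition stacked_rhs ::
    "('v, 'a::finite) diagram \<Rightarrow> real ^ 'm::finite \<Rightarrow> 'v + 'm \<Rightarrow> real" where
  "stacked_rhs D d = case_sum (\<lambda>u. of_bool (u = root_node D)) (\<lambda>i. d $ i)"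

lemma flow_polytope_eq_std_polyhedron:
  assumes "decision_diagram D"
  shows "flow_polytope D G d = std_polyhedron (Inl ` (UNIV - {terminal_node D})) (stacked_rows D)
    (stacked_matrix D G) (stacked_rhs D d)"
proof -
  have rows: "(\<forall>i\<in>stacked_rows D. Q i) \<longleftrightarrow> (\<forall>u. u \<noteq> terminal_node D \<longrightarrow> Q (Inl u)) \<and> (\<forall>i. Q (Inr i))"
    for Q :: "'a + 'c \<Rightarrow> bool"
    by (auto simp: stacked_rows_def)
  show ?thesis
    unfolding flow_polytope_def std_polyhedron_def rows
    by (auto simp: stacked_matrix_def stacked_rhs_def flow_constraints_iff[OF assms]
        matrix_vector_mult_def Finite_Cartesian_Product.less_eq_vec_def)
qed

lemma milp_feasible_in_flow_polytope:
  assumes "milp_feasible D G d y"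
  shows "y \<in> flow_polytope D G d"
proof -
  have "0 \<le> y $ a" for a
    using assms unfolding milp_feasible_def binary_vector_def by (metis insertE order_refl singletonD zero_le_one)
  with assms show ?thesis
    by (simp add: flow_polytope_def milp_feasible_def Finite_Cartesian_Product.less_eq_vec_def)
qed

text \<open>
  The layer bound makes the polytope bounded, which is what Krein-Milman requires.
\<close>
lemma flow_polytope_compact_convex:
  assumes "decision_diagram D"
  shows "compact (flow_polytope D G d)" "convex (flow_polytope D G d)"
proof -
  have "flow_polytope D G d \<subseteq> cbox 0 (\<chi> a. 1)"
    using flow_le_1[OF assms]
    by (auto simp: flow_polytope_def mem_box_cart Finite_Cartesian_Product.less_eq_vec_def)
  then have "bounded (flow_polytope D G d)"
    using bounded_cbox bounded_subset by blast
  then show "compact (flow_polytope D G d)"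
    by (simp add: compact_eq_bounded_closed flow_polytope_eq_std_polyhedron[OF assms] closed_std_polyhedron)
  show "convex (flow_polytope D G d)"
    by (simp add: flow_polytope_eq_std_polyhedron[OF assms] convex_std_polyhedron)
qed

lemma finite_stacked_rows: "finite (stacked_rows D :: ('v::finite + 'm::finite) set)"
  by (rule finite_subset[OF subset_UNIV]) simp

lemma equality_rows_subset: "Inl ` (UNIV - {terminal_node D}) \<subseteq> stacked_rows D"
  by (auto simp: stacked_rows_def)

text \<open>
  Integral coordinates between \<open>0\<close> and the layer bound \<open>1\<close> are binary.
\<close>
lemma flow_polytope_vertex_feasible:
  fixes G :: "real ^ 'a::finite ^ 'm::finite"
  assumes D: "decision_diagram D"
    and tu: "totally_unimodular (stacked_rows D) UNIV (stacked_matrix D G)"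
    and d: "\<And>i. d $ i \<in> \<int>"
    and x: "x extreme_point_of (flow_polytope D G d)"
  shows "milp_feasible D G d x"
proof -
  have P: "0 \<le> x" "flow_constraints D x" "G *v x \<le> d"
    using x by (auto simp: extreme_point_of_def flow_polytope_def)
  have "x $ a \<in> {0, 1}" for a
  proof -
    have "x $ a \<in> \<int>"
      using d x unfolding flow_polytope_eq_std_polyhedron[OF D]
      by (intro totally_unimodular_extreme_point_integral[OF finite_stacked_rows equality_rows_subset tu])
        (auto simp: stacked_rhs_def split: sum.split)
    moreover have "0 \<le> x $ a" "x $ a \<le> 1"
      using P flow_le_1[OF D] by (auto simp: Finite_Cartesian_Product.less_eq_vec_def)
    ultimately show ?thesis by (auto elim!: Ints_cases)
  qed
  with P show ?thesis by (simp add: milp_feasible_def binary_vector_def)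
qed

text \<open>
  The relaxation is exact: a half-space that contains all vertices contains their convex
  hull, which is the whole polytope.
\<close>
lemma milp_bound_imp_relaxation_bound:
  fixes G :: "real ^ 'a::finite ^ 'm::finite"
  assumes D: "decision_diagram D"
    and "totally_unimodular (stacked_rows D) UNIV (stacked_matrix D G)" "\<And>i. d $ i \<in> \<int>"
    and bound: "\<And>y. milp_feasible D G d y \<Longrightarrow> v \<le> c \<bullet> y"
    and x: "x \<in> flow_polytope D G d"
  shows "v \<le> c \<bullet> x"
proof -
  have "convex hull {x. x extreme_point_of (flow_polytope D G d)} \<subseteq> {x. v \<le> c \<bullet> x}"
    using flow_polytope_vertex_feasible[OF assms(1-3)] bound
    by (intro hull_minimal) (auto simp: convex_halfspace_ge)
  with Krein_Milman_Minkowski[OF flow_polytope_compact_convex[OF D]] x show ?thesis by blast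
qed

section \<open>Duality for the relaxation\<close>

text \<open>
  Normalizing the potential of the terminal to \<open>0\<close> compensates for its missing row, so
  that the incidence matrix turns potentials into potential differences along all arcs.
\<close>
lemma flow_matrix_transpose:
  assumes D: "decision_diagram D" and \<pi>: "\<pi> $ terminal_node D = 0"
  shows "(\<Sum>u\<in>UNIV - {terminal_node D}. \<pi> $ u * flow_matrix D u a) = \<pi> $ tail D a - \<pi> $ head D a"
proof -
  have "(\<Sum>u\<in>UNIV - {terminal_node D}. \<pi> $ u * flow_matrix D u a) = (\<Sum>u\<in>UNIV. \<pi> $ u * flow_matrix D u a)"
    using \<pi> by (intro sum.mono_neutral_left) auto
  also have "\<dots> = \<pi> $ tail D a - \<pi> $ head D a"
    by (simp add: flow_matrix_eq[OF D] right_diff_distrib sum_subtractf sum_mult_of_bool_eq)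
  finally show ?thesis .
qed

text \<open>
  Weighting the dual inequality of each arc with its flow and summing: by flow
  conservation the potential differences sum to the potential of the root, and the side constraints bound the
  remaining term.
\<close>
lemma weak_duality:
  assumes D: "decision_diagram D" and x: "x \<in> flow_polytope D G d"
    and \<gamma>: "0 \<le> \<gamma>" and \<pi>: "\<pi> $ terminal_node D = 0"
    and dual: "\<And>a. \<pi> $ tail D a - \<pi> $ head D a - \<gamma> \<bullet> column a G \<le> c $ a"
  shows "\<pi> $ root_node D - \<gamma> \<bullet> d \<le> c \<bullet> x"
proof -
  have P: "0 \<le> x" "flow_constraints D x" "G *v x \<le> d"
    using x by (auto simp: flow_polytope_def)
  have "(\<Sum>a\<in>UNIV. (\<pi> $ tail D a - \<pi> $ head D a) * x $ a) =
      (\<Sum>u\<in>UNIV - {terminal_node D}. \<pi> $ u * (\<Sum>a\<in>UNIV. flow_matrix D u a * x $ a))"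
    unfolding flow_matrix_transpose[where \<pi> = \<pi>, OF D \<pi>, symmetric] sum_distrib_left sum_distrib_right
    by (subst sum.swap) (simp add: mult.assoc)
  also have "\<dots> = (\<Sum>u\<in>UNIV - {terminal_node D}. \<pi> $ u * of_bool (u = root_node D))"
    using P(2) by (intro sum.cong) (auto simp: flow_constraints_iff[OF D])
  also have "\<dots> = \<pi> $ root_node D"
    using root_not_terminal[OF D] by (simp add: of_bool_def if_distrib[of "\<lambda>r. _ * r"] sum.delta cong: if_cong)
  finally have flow: "(\<Sum>a\<in>UNIV. (\<pi> $ tail D a - \<pi> $ head D a) * x $ a) = \<pi> $ root_node D" .
  have side: "(\<Sum>a\<in>UNIV. (\<gamma> \<bullet> column a G) * x $ a) = \<gamma> \<bullet> (G *v x)"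
    by (simp add: matrix_mult_sum inner_sum_right scalar_mult_eq_scaleR mult.commute)
  have "\<gamma> \<bullet> (G *v x) \<le> \<gamma> \<bullet> d"
    using \<gamma> P(3) unfolding inner_vec_def
    by (intro sum_mono) (auto simp: Finite_Cartesian_Product.less_eq_vec_def intro: mult_left_mono)
  then have "\<pi> $ root_node D - \<gamma> \<bullet> d \<le> (\<Sum>a\<in>UNIV. (\<pi> $ tail D a - \<pi> $ head D a - \<gamma> \<bullet> column a G) * x $ a)"
    using flow side by (simp add: left_diff_distrib sum_subtractf)
  also have "\<dots> \<le> (\<Sum>a\<in>UNIV. c $ a * x $ a)"
    using dual P(1) by (intro sum_mono mult_right_mono) (auto simp: Finite_Cartesian_Product.less_eq_vec_def)
  finally show ?thesis by (simp add: inner_vec_def)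
qed

text \<open>
  The multipliers of the flow rows are the potentials, extended by \<open>0\<close> to the terminal; those
  of the side constraints are nonpositive and become \<open>- \<gamma>\<close>.
\<close>
lemma strong_duality:
  fixes D :: "('v::finite, 'a::finite) diagram" and G :: "real ^ 'a ^ 'm::finite"
  assumes D: "decision_diagram D" and x0: "x0 \<in> flow_polytope D G d"
    and bound: "\<And>x. x \<in> flow_polytope D G d \<Longrightarrow> v \<le> c \<bullet> x"
  obtains \<pi> \<gamma> where "0 \<le> \<gamma>" "\<pi> $ terminal_node D = 0"
    "\<And>a. \<pi> $ tail D a - \<pi> $ head D a - \<gamma> \<bullet> column a G \<le> c $ a" "v \<le> \<pi> $ root_node D - \<gamma> \<bullet> d"
proof -
  let ?U = "UNIV - {terminal_node D}"
  obtain \<mu> where \<mu>: "\<And>i. i \<in> stacked_rows D - Inl ` ?U \<Longrightarrow> \<mu> i \<le> 0"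
      "\<And>a. (\<Sum>i\<in>stacked_rows D. \<mu> i * stacked_matrix D G i a) \<le> c $ a"
      "v \<le> (\<Sum>i\<in>stacked_rows D. \<mu> i * stacked_rhs D d i)"
    using std_polyhedron_dual_multipliers[OF finite_stacked_rows equality_rows_subset
        x0[unfolded flow_polytope_eq_std_polyhedron[OF D]], of v c]
      bound[unfolded flow_polytope_eq_std_polyhedron[OF D]] by blast
  define \<pi> where "\<pi> = (\<chi> u. if u = terminal_node D then 0 else \<mu> (Inl u))"
  define \<gamma> where "\<gamma> = (\<chi> i. - \<mu> (Inr i))"
  have \<pi>t: "\<pi> $ terminal_node D = 0" by (simp add: \<pi>_def)
  have split: "(\<Sum>i\<in>stacked_rows D. \<mu> i * q i) =
      (\<Sum>u\<in>?U. \<pi> $ u * q (Inl u)) - (\<Sum>i\<in>UNIV. \<gamma> $ i * q (Inr i))" for q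
    by (simp add: stacked_rows_def sum.Plus \<pi>_def \<gamma>_def sum_negf)
  show thesis
  proof (rule that[of \<gamma> \<pi>])
    show "0 \<le> \<gamma>"
      using \<mu>(1) by (auto simp: \<gamma>_def stacked_rows_def Finite_Cartesian_Product.less_eq_vec_def)
    show "\<pi> $ terminal_node D = 0" by fact
    show "\<pi> $ tail D a - \<pi> $ head D a - \<gamma> \<bullet> column a G \<le> c $ a" for a
      using \<mu>(2)[of a] flow_matrix_transpose[where \<pi> = \<pi>, OF D \<pi>t, of a]
      by (simp add: split stacked_matrix_def inner_vec_def column_def)
    show "v \<le> \<pi> $ root_node D - \<gamma> \<bullet> d"
      using \<mu>(3) root_not_terminal[OF D]
      by (simp add: split stacked_rhs_def inner_vec_def of_bool_def if_distrib[of "\<lambda>r. _ * r"]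
          cong: if_cong)
  qed
qed

section \<open>Optimal solutions of the binary program\<close>

theorem proposition4:
  fixes D :: "('v::finite, 'a::finite) diagram"
    and X :: "int list set" and f :: "int list \<Rightarrow> real"
    and G :: "real ^ 'a ^ 'm::finite" and d :: "real ^ 'm"
  assumes "decision_diagram D"
    and "encodes D X f"
    and "\<And>i a. G $ i $ a \<ge> 0"
    and "\<And>i. d $ i \<ge> 0"
    and "\<exists>p\<in>rt_paths D. G *v path_vector p \<le> d"
    and "totally_unimodular (stacked_rows D) UNIV (stacked_matrix D G)"
    and "\<And>i. d $ i \<in> \<int>"
  shows "milp_optimal_solutions D G d = fst ` opt_system D G d"
proof (intro equalityI subsetI)
  fix y assume "y \<in> milp_optimal_solutions D G d"
  then have y: "milp_feasible D G d y"
    and min: "\<And>z. milp_feasible D G d z \<Longrightarrow> arc_length D \<bullet> y \<le> arc_length D \<bullet> z"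
    by (auto simp: milp_optimal_solutions_def is_arg_min_def not_less)
  note yP = milp_feasible_in_flow_polytope[OF y]
  have relax: "arc_length D \<bullet> y \<le> arc_length D \<bullet> x" if "x \<in> flow_polytope D G d" for x
    by (rule milp_bound_imp_relaxation_bound[OF assms(1,6,7) min that])
  obtain \<pi> \<gamma> where \<gamma>: "0 \<le> \<gamma>" and \<pi>: "\<pi> $ terminal_node D = 0"
    and dual: "\<And>a. \<pi> $ tail D a - \<pi> $ head D a - \<gamma> \<bullet> column a G \<le> arc_length D $ a"
    and le: "arc_length D \<bullet> y \<le> \<pi> $ root_node D - \<gamma> \<bullet> d"
    by (rule strong_duality[OF assms(1) yP]) (use relax that in auto)
  have "\<pi> $ root_node D - \<gamma> \<bullet> d \<le> arc_length D \<bullet> y"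
    by (rule weak_duality[OF assms(1) yP \<gamma> \<pi> dual])
  with y \<gamma> \<pi> dual le have "(y, \<pi>, \<gamma>) \<in> opt_system D G d"
    by (simp add: opt_system_def milp_feasible_def)
  then show "y \<in> fst ` opt_system D G d" by force
next
  fix y assume "y \<in> fst ` opt_system D G d"
  then obtain \<pi> \<gamma> where sys: "(y, \<pi>, \<gamma>) \<in> opt_system D G d" by auto
  then have "milp_feasible D G d y"
    by (simp add: opt_system_def milp_feasible_def)
  moreover have "arc_length D \<bullet> y \<le> arc_length D \<bullet> z" if "milp_feasible D G d z" for z
    using weak_duality[OF assms(1) milp_feasible_in_flow_polytope[OF that], of \<gamma> \<pi> "arc_length D"] sys
    by (simp add: opt_system_def)
  ultimately show "y \<in> milp_optimal_solutions D G d"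
    by (force simp: milp_optimal_solutions_def is_arg_min_def not_less)
qed

end
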